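(* For each graph $G$, the $\ell$-link graph $\mathbb{L}_\ell(G)$ is $3$-colourable in the following cases: (1) $\ell \geqslant 0$ is an even integer, and either $\chi(G) \leqslant 3$ or $\ell > 2\log_{1.5}(\chi(G) - 3)$. (2) $\ell \geqslant 1$ is an odd integer, and either $\chi'(G) \leqslant 3$ or $\ell > 2\log_{1.5}(\chi'(G) - 3) + 1$.
   Context: All graphs are finite, undirected and loopless; parallel edges are allowed. For an integer $\ell \geqslant 0$, an $\ell$-arc of $G$ is an alternating sequence $\vec{L} = (v_0, e_1, v_1, \ldots, e_\ell, v_\ell)$ of vertices and edges of $G$ such that $e_i$ has end vertices $v_{i-1}, v_i$ for $1 \leqslant i \leqslant \ell$, and $e_i \neq e_{i+1}$ for $1 \leqslant i \leqslant \ell - 1$ (vertices and non-consecutive edges may repeat). An $\ell$-link is an $\ell$-arc identified with its reverse sequence, written $L = [v_0, e_1, \ldots, e_\ell, v_\ell]$. For an $\ell$-arc $\vec{L}$ and $0 \leqslant i \leqslant j \leqslant \ell$, $\vec{L}[i,j]$ is the $(j-i)$-link $[v_i, e_{i+1}, \ldots, e_j, v_j]$. The $\ell$-link graph $\mathbb{L}_\ell(G)$ has as vertices the $\ell$-links of $G$, and the number of edges between two $\ell$-links $L, R$ is the number of $(\ell+1)$-links $Q$ of $G$ such that $\{\vec{Q}[0,\ell], \vec{Q}[1,\ell+1]\} = \{L, R\}$ ($\vec Q$ being either of the two $(\ell+1)$-arcs representing $Q$; the two $\ell$-links $\vec{Q}[0,\ell]$ and $\vec{Q}[1,\ell+1]$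 are always distinct, so $\mathbb{L}_\ell(G)$ is loopless). $\chi(G)$ is the chromatic number; $\chi'(G)$ is the edge-chromatic number (least number of colours on edges so that distinct edges sharing an end vertex get different colours). The logarithmic alternatives are meant for $\chi(G) > 3$, respectively $\chi'(G) > 3$. A graph is $3$-colourable if it has a proper vertex colouring with colours from $\{1,2,3\}$. *)

theory Defs
  imports Complex_Main
begin

record ('v, 'e) mgraph =
  verts :: "'v set"
  edges :: "'e set"
  ends :: "'e \<Rightarrow> 'v set"

text \<open>Finite, undirected, loopless, parallel edges allowed: an edge is an abstract object, and
  looplessness is the requirement that it has exactly two ends.\<close>

definition finite_mgraph :: "('v, 'e) mgraph \<Rightarrow> bool" where
  "finite_mgraph G \<longleftrightarrow> finite (verts G) \<and> finite (edges G) \<and>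
     (\<forall>e\<in>edges G. ends G e \<subseteq> verts G \<and> card (ends G e) = 2)"

definition proper_colouring :: "('v, 'e) mgraph \<Rightarrow> nat \<Rightarrow> ('v \<Rightarrow> nat) \<Rightarrow> bool" where
  "proper_colouring G k c \<longleftrightarrow> (\<forall>v\<in>verts G. c v \<in> {1..k}) \<and>
     (\<forall>e\<in>edges G. \<forall>u v. ends G e = {u, v} \<longrightarrow> c u \<noteq> c v)"

definition colourable :: "('v, 'e) mgraph \<Rightarrow> nat \<Rightarrow> bool" where
  "colourable G k \<longleftrightarrow> (\<exists>c. proper_colouring G k c)"

definition chromatic_number :: "('v, 'e) mgraph \<Rightarrow> nat" where
  "chromatic_number G = (LEAST k. colourable G k)"

definition proper_edge_colouring :: "('v, 'e) mgraph \<Rightarrow> nat \<Rightarrow> ('e \<Rightarrow> nat) \<Rightarrow> bool" where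
  "proper_edge_colouring G k c \<longleftrightarrow> (\<forall>e\<in>edges G. c e \<in> {1..k}) \<and>
     (\<forall>e\<in>edges G. \<forall>f\<in>edges G. e \<noteq> f \<and> ends G e \<inter> ends G f \<noteq> {} \<longrightarrow> c e \<noteq> c f)"

definition edge_colourable :: "('v, 'e) mgraph \<Rightarrow> nat \<Rightarrow> bool" where
  "edge_colourable G k \<longleftrightarrow> (\<exists>c. proper_edge_colouring G k c)"

definition edge_chromatic_number :: "('v, 'e) mgraph \<Rightarrow> nat" where
  "edge_chromatic_number G = (LEAST k. edge_colourable G k)"

text \<open>The alternating sequence $(v_0, e_1, v_1, \ldots, e_l, v_l)$ is stored as the pair of lists
  $[v_0, \ldots, v_l]$ and $[e_1, \ldots, e_l]$; lists being indexed from 0, $e_i$ is the list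
  entry at position $i - 1$.\<close>

type_synonym ('v, 'e) arc = "'v list \<times> 'e list"

definition arcs :: "nat \<Rightarrow> ('v, 'e) mgraph \<Rightarrow> ('v, 'e) arc set" where
  "arcs l G = {(vs, es). length vs = l + 1 \<and> length es = l \<and>
     set vs \<subseteq> verts G \<and> set es \<subseteq> edges G \<and>
     (\<forall>i<l. ends G (es ! i) = {vs ! i, vs ! (i + 1)}) \<and>
     (\<forall>i. i + 1 < l \<longrightarrow> es ! i \<noteq> es ! (i + 1))}"

definition rev_arc :: "('v, 'e) arc \<Rightarrow> ('v, 'e) arc" where
  "rev_arc q = (rev (fst q), rev (snd q))"

text \<open>A link is the equivalence class of an arc under reversal.\<close>

definition link_of :: "('v, 'e) arc \<Rightarrow> ('v, 'e) arc set" where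
  "link_of q = {q, rev_arc q}"

definition links :: "nat \<Rightarrow> ('v, 'e) mgraph \<Rightarrow> ('v, 'e) arc set set" where
  "links l G = link_of ` arcs l G"

definition sublink :: "('v, 'e) arc \<Rightarrow> nat \<Rightarrow> nat \<Rightarrow> ('v, 'e) arc set" where
  "sublink q i j = link_of (take (j - i + 1) (drop i (fst q)), take (j - i) (drop i (snd q)))"

text \<open>The edges of the \<open>l\<close>-link graph are the \<open>(l + 1)\<close>-links \<open>Q\<close> themselves, so that
  multiplicities come out right. Both arcs representing \<open>Q\<close> contribute the same pair to the
  union; see \<open>ends_link_graph\<close> below.\<close>

definition link_graph :: "nat \<Rightarrow> ('v, 'e) mgraph \<Rightarrow> (('v, 'e) arc set, ('v, 'e) arc set) mgraph"
  where
  "link_graph l G = \<lparr>verts = links l G, edges = links (l + 1) G,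
     ends = (\<lambda>Q. \<Union>q\<in>Q. {sublink q 0 l, sublink q 1 (l + 1)})\<rparr>"

lemma rev_arc_rev_arc: "rev_arc (rev_arc q) = q"
  by (simp add: rev_arc_def)

lemma link_of_rev_arc: "link_of (rev_arc q) = link_of q"
  by (auto simp: link_of_def rev_arc_rev_arc)

lemma rev_arc_in_arcs:
  assumes "q \<in> arcs l G"
  shows "rev_arc q \<in> arcs l G"
proof -
  obtain vs es where q: "q = (vs, es)" by (cases q)
  have len: "length vs = l + 1" "length es = l"
    and inc: "\<And>i. i < l \<Longrightarrow> ends G (es ! i) = {vs ! i, vs ! (i + 1)}"
    and ne: "\<And>i. i + 1 < l \<Longrightarrow> es ! i \<noteq> es ! (i + 1)"
    and sub: "set vs \<subseteq> verts G" "set es \<subseteq> edges G"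
    using assms by (auto simp: q arcs_def)
  have "ends G (rev es ! i) = {rev vs ! i, rev vs ! (i + 1)}" if "i < l" for i
  proof -
    have eq: "l - Suc i + 1 = l - i" using that by simp
    have "rev es ! i = es ! (l - Suc i)" "rev vs ! i = vs ! (l - i)"
      "rev vs ! (i + 1) = vs ! (l - Suc i)"
      using that len by (simp_all add: rev_nth)
    then show ?thesis using inc[of "l - Suc i"] that by (simp add: eq[simplified] insert_commute)
  qed
  moreover have "rev es ! i \<noteq> rev es ! (i + 1)" if "i + 1 < l" for i
  proof -
    have "rev es ! i = es ! (l - Suc (i + 1) + 1)" "rev es ! (i + 1) = es ! (l - Suc (i + 1))"
      using that len by (auto simp: rev_nth intro!: arg_cong[where f = "(!) es"])
    moreover have "l - Suc (i + 1) + 1 < l" using that by arith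
    ultimately show ?thesis using ne[of "l - Suc (i + 1)"] by metis
  qed
  ultimately show ?thesis
    using len sub by (auto simp: q rev_arc_def arcs_def)
qed

lemma sublink_rev_arc:
  assumes "q \<in> arcs (l + 1) G"
  shows "sublink (rev_arc q) 0 l = sublink q 1 (l + 1)"
    and "sublink (rev_arc q) 1 (l + 1) = sublink q 0 l"
proof -
  have len: "length (fst q) = l + 2" "length (snd q) = l + 1"
    using assms by (auto simp: arcs_def)
  have 1: "(take (Suc l) (rev (fst q)), take l (rev (snd q)))
      = rev_arc (take (Suc l) (drop 1 (fst q)), take l (drop 1 (snd q)))"
    using len by (simp add: rev_arc_def take_rev)
  have 2: "(take (Suc l) (drop 1 (rev (fst q))), take l (drop 1 (rev (snd q))))
      = rev_arc (take (Suc l) (fst q), take l (snd q))"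
    using len by (simp add: rev_arc_def drop_rev)
  show "sublink (rev_arc q) 0 l = sublink q 1 (l + 1)"
    using 1 by (simp add: sublink_def link_of_def rev_arc_def insert_commute)
  show "sublink (rev_arc q) 1 (l + 1) = sublink q 0 l"
    using 2 by (simp add: sublink_def link_of_def rev_arc_def insert_commute)
qed

lemma ends_link_graph:
  assumes "q \<in> arcs (l + 1) G"
  shows "ends (link_graph l G) (link_of q) = {sublink q 0 l, sublink q 1 (l + 1)}"
  using sublink_rev_arc[OF assms] by (auto simp: link_graph_def link_of_def)

lemma sublink_in_links:
  assumes "q \<in> arcs (l + 1) G"
  shows "sublink q 0 l \<in> links l G" "sublink q 1 (l + 1) \<in> links l G"
proof -
  have 0: "sublink r 0 l \<in> links l G" if "r \<in> arcs (l + 1) G" for r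
  proof -
    have "(take (l + 1) (fst r), take l (snd r)) \<in> arcs l G"
      using that set_take_subset[of "l + 1" "fst r"] set_take_subset[of l "snd r"]
      by (auto simp: arcs_def subset_iff)
    then show ?thesis by (auto simp: sublink_def links_def)
  qed
  show "sublink q 0 l \<in> links l G" using 0 assms .
  show "sublink q 1 (l + 1) \<in> links l G"
    using 0[OF rev_arc_in_arcs[OF assms]] sublink_rev_arc[OF assms] by simp
qed

lemma sublink_distinct:
  assumes G: "finite_mgraph G" and q: "q \<in> arcs (l + 1) G"
  shows "sublink q 0 l \<noteq> sublink q 1 (l + 1)"
proof
  assume eq: "sublink q 0 l = sublink q 1 (l + 1)"
  obtain vs es where qq: "q = (vs, es)" by (cases q)
  have len: "length vs = l + 2" "length es = l + 1"
    and ed: "set es \<subseteq> edges G"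
    and inc: "\<And>i. i < l + 1 \<Longrightarrow> ends G (es ! i) = {vs ! i, vs ! (i + 1)}"
    and ne: "\<And>i. i < l \<Longrightarrow> es ! i \<noteq> es ! (i + 1)"
    using q by (auto simp: qq arcs_def)
  have vne: "vs ! i \<noteq> vs ! (i + 1)" if "i < l + 1" for i
  proof -
    have "es ! i \<in> edges G" using that len ed by auto
    then have "card {vs ! i, vs ! (i + 1)} = 2"
      using G inc[OF that] unfolding finite_mgraph_def by metis
    then show ?thesis by auto
  qed
  consider "take (l + 1) vs = drop 1 vs"
    | "take (l + 1) vs = rev (drop 1 vs)" "take l es = rev (drop 1 es)"
    using eq len by (auto simp: sublink_def link_of_def rev_arc_def qq doubleton_eq_iff)
  then show False
  proof cases
    case 1
    then have "take (l + 1) vs ! 0 = drop 1 vs ! 0" by simp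
    then show False using vne[of 0] len by simp
  next
    case 2
    show False
    proof (cases "even l")
      case True
      then obtain k where k: "l = 2 * k" by blast
      have "take (l + 1) vs ! k = rev (drop 1 vs) ! k" using 2 by simp
      then show False using vne[of k] len k by (simp add: rev_nth)
    next
      case False
      then obtain k where k: "l = 2 * k + 1" by (blast elim: oddE)
      have "take l es ! k = rev (drop 1 es) ! k" using 2 by simp
      then show False using ne[of k] len k by (simp add: rev_nth)
    qed
  qed
qed

lemma finite_links:
  assumes "finite_mgraph G"
  shows "finite (links l G)"
proof -
  have "arcs l G \<subseteq> {vs. set vs \<subseteq> verts G \<and> length vs = l + 1} \<times>
      {es. set es \<subseteq> edges G \<and> length es = l}"
    by (auto simp: arcs_def)
  moreover have "finite ({vs. set vs \<subseteq> verts G \<and> length vs = l + 1} \<times>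
      {es. set es \<subseteq> edges G \<and> length es = l})"
    using assms by (intro finite_cartesian_product finite_lists_length_eq)
      (auto simp: finite_mgraph_def)
  ultimately show ?thesis unfolding links_def by (blast intro: finite_subset)
qed

lemma finite_mgraph_link_graph:
  assumes "finite_mgraph G"
  shows "finite_mgraph (link_graph l G)"
proof -
  have "ends (link_graph l G) Q \<subseteq> verts (link_graph l G) \<and> card (ends (link_graph l G) Q) = 2"
    if "Q \<in> edges (link_graph l G)" for Q
  proof -
    obtain q where q: "q \<in> arcs (l + 1) G" "Q = link_of q"
      using \<open>Q \<in> edges (link_graph l G)\<close> by (auto simp: link_graph_def links_def)
    have "verts (link_graph l G) = links l G" by (simp add: link_graph_def)
    moreover have "ends (link_graph l G) Q = {sublink q 0 l, sublink q 1 (l + 1)}"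
      using ends_link_graph q by blast
    ultimately show ?thesis
      using sublink_in_links[OF q(1)] sublink_distinct[OF assms q(1)] by simp
  qed
  then show ?thesis
    using finite_links[OF assms] by (simp add: finite_mgraph_def link_graph_def)
qed

end

theory Submission
  imports Defs
begin

text \<open>Deleting both end edges of an \<open>(l + 2)\<close>-link leaves an \<open>l\<close>-link, its middle, and adjacent
  \<open>(l + 2)\<close>-links have adjacent middles. So every colouring of the \<open>l\<close>-link graph induces one of the
  \<open>(l + 2)\<close>-link graph. There is something to gain, because an \<open>(l + 2)\<close>-link \<open>L\<close> knows more than
  its middle: all its neighbours have as their middles just two \<open>l\<close>-links, the initial and the final
  one of \<open>L\<close>. A vertex of the induced colouring thus sees at most two colours \<open>a\<close> and \<open>b\<close>,
  and these depend on \<open>L\<close> alone.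

  This allows about a third of the colours to be given up. Each abandoned colour owns two surviving
  colours \<open>x\<close> and \<open>y\<close>, and there is one more surviving colour \<open>z\<close> common to all. A link of the
  abandoned colour takes \<open>x\<close> or \<open>y\<close> if one of them is not in \<open>{a, b}\<close>, and \<open>z\<close> otherwise. In the
  last case \<open>{a, b} = {x, y}\<close>, so that all neighbours keep a colour different from \<open>z\<close>; in the
  first case no neighbour that keeps its colour is in conflict, and neither is one that is
  recoloured as well, since it uses the pair of another abandoned colour, or \<open>z\<close>. In this way \<open>k\<close>
  colours are reduced to \<open>k - (k - 1) div 3\<close>, so that the excess over 3 becomes at most
  \<open>2 / 3\<close> of what it was (\<open>colourable_link_graph_add_2\<close>).

  The 0-link graph is \<open>G\<close>, and the 1-link graph is the line graph of \<open>G\<close> with multiplicities, so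
  iteration starts from \<open>\<chi>(G)\<close> or \<open>\<chi>'(G)\<close> colours. After \<open>t\<close> steps the excess, an integer, is at
  most \<open>(2 / 3) ^ t\<close> times the initial one; the logarithmic hypothesis says that this is below 1.\<close>

section \<open>Colourings of link graphs as reversal-invariant colourings of arcs\<close>

definition arc_init :: "('v, 'e) arc \<Rightarrow> ('v, 'e) arc" where
  "arc_init q = (butlast (fst q), butlast (snd q))"

definition arc_tail :: "('v, 'e) arc \<Rightarrow> ('v, 'e) arc" where
  "arc_tail q = (tl (fst q), tl (snd q))"

lemma arc_init_arc_tail: "arc_init (arc_tail q) = arc_tail (arc_init q)"
  by (simp add: arc_init_def arc_tail_def butlast_tl)

lemma arc_init_rev_arc: "arc_init (rev_arc q) = rev_arc (arc_tail q)"
  by (simp add: arc_init_def arc_tail_def rev_arc_def butlast_rev)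

lemma arc_tail_rev_arc: "arc_tail (rev_arc q) = rev_arc (arc_init q)"
  by (metis arc_init_rev_arc rev_arc_rev_arc)

lemma arc_init_in_arcs:
  assumes "q \<in> arcs (Suc l) G"
  shows "arc_init q \<in> arcs l G"
  using assms by (auto simp: arcs_def arc_init_def nth_butlast subset_iff dest: in_set_butlastD)

lemma arc_tail_in_arcs:
  assumes "q \<in> arcs (Suc l) G"
  shows "arc_tail q \<in> arcs l G"
  using arc_init_in_arcs[OF rev_arc_in_arcs[OF assms]] rev_arc_in_arcs
  by (metis arc_init_rev_arc rev_arc_rev_arc)

lemma sublink_eq_link_of:
  assumes "q \<in> arcs (Suc l) G"
  shows "sublink q 0 l = link_of (arc_init q)"
    and "sublink q 1 (Suc l) = link_of (arc_tail q)"
  using assms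
  by (auto simp: arcs_def sublink_def arc_init_def arc_tail_def butlast_conv_take drop_Suc)

definition arc_colouring ::
    "nat \<Rightarrow> ('v, 'e) mgraph \<Rightarrow> nat \<Rightarrow> (('v, 'e) arc \<Rightarrow> nat) \<Rightarrow> bool" where
  "arc_colouring l G k c \<longleftrightarrow>
     (\<forall>p\<in>arcs l G. c p \<in> {1..k} \<and> c (rev_arc p) = c p) \<and>
     (\<forall>q\<in>arcs (Suc l) G. c (arc_init q) \<noteq> c (arc_tail q))"

text \<open>Deleting the first or the last edge is an operation on arcs; on links the two are only defined
  as an unordered pair. Passing to arcs turns adjacency into an identity between these operations,
  at the price of keeping colours invariant under reversal.\<close>

lemma colourable_link_graph_iff_arc_colouring:
  "colourable (link_graph l G) k \<longleftrightarrow> (\<exists>c. arc_colouring l G k c)"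
proof
  assume "colourable (link_graph l G) k"
  then obtain C where C: "proper_colouring (link_graph l G) k C"
    unfolding colourable_def by blast
  have "C (link_of (arc_init q)) \<noteq> C (link_of (arc_tail q))" if q: "q \<in> arcs (Suc l) G" for q
  proof -
    have "link_of q \<in> edges (link_graph l G)"
      using q by (simp add: link_graph_def links_def)
    moreover have "ends (link_graph l G) (link_of q)
        = {link_of (arc_init q), link_of (arc_tail q)}"
      using ends_link_graph[of q l G] sublink_eq_link_of[OF q] q by simp
    ultimately show ?thesis
      using C unfolding proper_colouring_def by blast
  qed
  moreover have "C (link_of p) \<in> {1..k}" if "p \<in> arcs l G" for p
    using C that unfolding proper_colouring_def by (simp add: link_graph_def links_def)
  ultimately have "arc_colouring l G k (\<lambda>p. C (link_of p))"
    unfolding arc_colouring_def by (simp add: link_of_rev_arc)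
  then show "\<exists>c. arc_colouring l G k c" by blast
next
  assume "\<exists>c. arc_colouring l G k c"
  then obtain c where c: "arc_colouring l G k c" by blast
  define C where "C X = c (SOME p. p \<in> X)" for X
  have C: "C (link_of p) = c p" if "p \<in> arcs l G" for p
  proof -
    have "(SOME r. r \<in> link_of p) \<in> link_of p"
      by (rule someI[of _ p]) (simp add: link_of_def)
    then show ?thesis
      using c that unfolding C_def arc_colouring_def by (auto simp: link_of_def)
  qed
  have "C X \<noteq> C Y"
    if e: "e \<in> edges (link_graph l G)" and XY: "ends (link_graph l G) e = {X, Y}" for e X Y
  proof -
    obtain q where q: "q \<in> arcs (Suc l) G" "e = link_of q"
      using e by (auto simp: link_graph_def links_def)
    have "{X, Y} = {link_of (arc_init q), link_of (arc_tail q)}"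
      using ends_link_graph[of q l G] sublink_eq_link_of[OF q(1)] q XY by simp
    moreover have "C (link_of (arc_init q)) \<noteq> C (link_of (arc_tail q))"
      using c q(1) C[OF arc_init_in_arcs[OF q(1)]] C[OF arc_tail_in_arcs[OF q(1)]]
      by (simp add: arc_colouring_def)
    ultimately show ?thesis by (metis doubleton_eq_iff)
  qed
  moreover have "C X \<in> {1..k}" if "X \<in> verts (link_graph l G)" for X
    using that c C by (auto simp: link_graph_def links_def arc_colouring_def)
  ultimately have "proper_colouring (link_graph l G) k C"
    unfolding proper_colouring_def by blast
  then show "colourable (link_graph l G) k"
    unfolding colourable_def by blast
qed

lemma colourable_mono:
  assumes "colourable G k" "k \<le> k'"
  shows "colourable G k'"
  using assms unfolding colourable_def proper_colouring_def by fastforce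

section \<open>Giving up a third of the colours\<close>

definition reduced_colours :: "nat \<Rightarrow> nat" where
  "reduced_colours k = k - (k - 1) div 3"

text \<open>The colours above \<open>reduced_colours k\<close> are abandoned. The \<open>i\<close>-th of them owns the pair
  \<open>{2 * i, 2 * i + 1}\<close>, and 1 is the common reserve. The arguments \<open>a\<close> and \<open>b\<close> are the colours seen
  in the neighbourhood of a vertex of colour \<open>s\<close>.\<close>

definition recolour :: "nat \<Rightarrow> nat \<Rightarrow> nat \<Rightarrow> nat \<Rightarrow> nat" where
  "recolour k s a b =
     (let i = s - reduced_colours k in
      if s \<le> reduced_colours k then s
      else if 2 * i \<notin> {a, b} then 2 * i
      else if 2 * i + 1 \<notin> {a, b} then 2 * i + 1
      else 1)"

text \<open>With \<open>m = (k - 1) div 3\<close> abandoned colours, their pairs and the reserve are the colours up to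
  \<open>2 * m + 1\<close>, and these survive because \<open>3 * m + 1 \<le> k\<close>.\<close>

lemma abandoned_colour_pair_survives:
  assumes "s \<le> k" "reduced_colours k < s"
  shows "2 * (s - reduced_colours k) + 1 \<le> reduced_colours k"
  using assms unfolding reduced_colours_def by linarith

lemma recolour_commute: "recolour k s a b = recolour k s b a"
  by (auto simp: recolour_def Let_def)

lemma recolour_range:
  assumes "s \<in> {1..k}"
  shows "recolour k s a b \<in> {1..reduced_colours k}"
  using assms abandoned_colour_pair_survives[of s k] by (auto simp: recolour_def Let_def)

text \<open>The vertices of colours \<open>s\<close> and \<open>t\<close> are adjacent, so each of the two colours is among those
  that the other vertex sees. If both are abandoned, then neither vertex resorts to the reserve,
  since the other one uses up one of the two seen colours without blocking any of the pair.\<close>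

lemma recolour_neq:
  assumes "s \<in> {1..k}" "t \<in> {1..k}" "s \<noteq> t"
  shows "recolour k s a t \<noteq> recolour k t s b"
proof -
  let ?r = "reduced_colours k"
  have s: "2 * (s - ?r) + 1 \<le> ?r" if "\<not> s \<le> ?r"
    using abandoned_colour_pair_survives[of s k] assms that by simp
  have t: "2 * (t - ?r) + 1 \<le> ?r" if "\<not> t \<le> ?r"
    using abandoned_colour_pair_survives[of t k] assms that by simp
  show ?thesis
  proof (cases "s \<le> ?r"; cases "t \<le> ?r")
    assume "s \<le> ?r" "t \<le> ?r"
    then show ?thesis using assms by (simp add: recolour_def)
  next
    assume *: "s \<le> ?r" "\<not> t \<le> ?r"
    show ?thesis using * t[OF *(2)] by (auto simp: recolour_def Let_def)
  next
    assume *: "\<not> s \<le> ?r" "t \<le> ?r"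
    show ?thesis using * s[OF *(1)] by (auto simp: recolour_def Let_def)
  next
    assume *: "\<not> s \<le> ?r" "\<not> t \<le> ?r"
    have "recolour k s a t \<in> {2 * (s - ?r), 2 * (s - ?r) + 1}"
      using * s[OF *(1)] by (auto simp: recolour_def Let_def)
    moreover have "recolour k t s b \<in> {2 * (t - ?r), 2 * (t - ?r) + 1}"
      using * t[OF *(2)] by (auto simp: recolour_def Let_def)
    moreover have "s - ?r \<noteq> t - ?r" using * assms by linarith
    ultimately show ?thesis by auto
  qed
qed

lemma colourable_link_graph_add_2:
  assumes "colourable (link_graph l G) k"
  shows "colourable (link_graph (l + 2) G) (reduced_colours k)"
proof -
  obtain c where c: "arc_colouring l G k c"
    using assms colourable_link_graph_iff_arc_colouring by blast
  have rng: "c p \<in> {1..k}" and inv: "c (rev_arc p) = c p" if "p \<in> arcs l G" for p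
    using c that unfolding arc_colouring_def by auto
  have adj: "c (arc_init q) \<noteq> c (arc_tail q)" if "q \<in> arcs (Suc l) G" for q
    using c that unfolding arc_colouring_def by auto
  note sub = arc_init_in_arcs arc_tail_in_arcs
  define C where "C p = recolour k (c (arc_tail (arc_init p)))
      (c (arc_init (arc_init p))) (c (arc_tail (arc_tail p)))" for p
  have "C p \<in> {1..reduced_colours k} \<and> C (rev_arc p) = C p" if p: "p \<in> arcs (l + 2) G" for p
  proof
    have p': "p \<in> arcs (Suc (Suc l)) G" using p by simp
    then show "C p \<in> {1..reduced_colours k}"
      unfolding C_def by (intro recolour_range rng sub)
    show "C (rev_arc p) = C p"
      unfolding C_def arc_init_rev_arc arc_tail_rev_arc
      using p' by (simp add: inv sub arc_init_arc_tail recolour_commute)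
  qed
  moreover have "C (arc_init q) \<noteq> C (arc_tail q)" if q: "q \<in> arcs (Suc (l + 2)) G" for q
  proof -
    have q': "q \<in> arcs (Suc (Suc (Suc l))) G" using q by simp
    \<comment> \<open>The two middles are the initial and the final \<open>l\<close>-arc of the middle of \<open>q\<close>.\<close>
    let ?s = "arc_tail (arc_init (arc_init q))" and ?t = "arc_tail (arc_tail (arc_init q))"
    have "c ?s \<noteq> c ?t"
      using adj[of "arc_tail (arc_init q)"] q' by (simp add: sub arc_init_arc_tail)
    moreover have "c ?s \<in> {1..k}" "c ?t \<in> {1..k}"
      using q' by (intro rng sub; simp)+
    ultimately have "recolour k (c ?s) (c (arc_init (arc_init (arc_init q)))) (c ?t)
        \<noteq> recolour k (c ?t) (c ?s) (c (arc_tail (arc_tail (arc_tail q))))"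
      by (intro recolour_neq)
    then show ?thesis unfolding C_def by (simp add: arc_init_arc_tail)
  qed
  ultimately have "arc_colouring (l + 2) G (reduced_colours k) C"
    unfolding arc_colouring_def by blast
  then show ?thesis using colourable_link_graph_iff_arc_colouring by blast
qed

section \<open>Iterating down to three colours\<close>

lemma reduced_colours_excess:
  assumes "k \<ge> 3"
  shows "reduced_colours k \<ge> 3"
    and "real (reduced_colours k) - 3 \<le> 2 / 3 * (real k - 3)"
proof -
  show "reduced_colours k \<ge> 3" using assms unfolding reduced_colours_def by linarith
  have "3 * reduced_colours k \<le> 2 * k + 3" using assms unfolding reduced_colours_def by linarith
  then have "3 * real (reduced_colours k) \<le> 2 * real k + 3" by linarith
  then show "real (reduced_colours k) - 3 \<le> 2 / 3 * (real k - 3)" by simp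
qed

lemma colourable_link_graph_add_even:
  assumes "colourable (link_graph l G) k" "k \<ge> 3"
  shows "\<exists>k'\<ge>3. colourable (link_graph (l + 2 * t) G) k' \<and> real k' - 3 \<le> (2 / 3) ^ t * (real k - 3)"
proof (induction t)
  case 0
  then show ?case using assms by auto
next
  case (Suc t)
  then obtain k' where k': "k' \<ge> 3" "colourable (link_graph (l + 2 * t) G) k'"
    "real k' - 3 \<le> (2 / 3) ^ t * (real k - 3)" by blast
  have "real (reduced_colours k') - 3 \<le> (2 / 3) ^ Suc t * (real k - 3)"
    using reduced_colours_excess(2)[OF k'(1)] k'(3) by simp
  then show ?case
    using reduced_colours_excess(1)[OF k'(1)] colourable_link_graph_add_2[OF k'(2)] by auto
qed

lemma colourable_link_graph_3:
  assumes "colourable (link_graph l G) k"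
    and "k \<le> 3 \<or> real t > log (3 / 2) (real k - 3)"
  shows "colourable (link_graph (l + 2 * t) G) 3"
proof -
  \<comment> \<open>With fewer than 3 colours the excess would be negative, and growing towards 0.\<close>
  let ?k = "max 3 k"
  have "(2 / 3) ^ t * (real ?k - 3) < 1"
  proof (cases "k \<le> 3")
    case False
    then have "real k - 3 < (3 / 2) powr real t"
      using assms(2) log_less_iff[of "3 / 2" "real k - 3" "real t"] by simp
    then have "real k - 3 < (3 / 2) ^ t" by (simp add: powr_realpow)
    then have "(2 / 3) ^ t * (real k - 3) < (2 / 3) ^ t * (3 / 2) ^ t" by simp
    also have "\<dots> = 1" by (simp flip: power_mult_distrib)
    finally show ?thesis using False by (simp add: max_def)
  qed simp
  moreover obtain k' where "k' \<ge> 3" "colourable (link_graph (l + 2 * t) G) k'"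
    "real k' - 3 \<le> (2 / 3) ^ t * (real ?k - 3)"
    using colourable_link_graph_add_even[OF colourable_mono[OF assms(1), of ?k], of t] by auto
  moreover from calculation have "k' = 3" by linarith
  ultimately show ?thesis by simp
qed

section \<open>Links of length zero and one\<close>

lemma colourable_chromatic_number:
  assumes "finite_mgraph G"
  shows "colourable G (chromatic_number G)"
proof -
  obtain f where "bij_betw f (verts G) {1..card (verts G)}"
    using assms finite_same_card_bij[of "verts G" "{1..card (verts G)}"]
    unfolding finite_mgraph_def by auto
  then have f: "inj_on f (verts G)" "f ` verts G = {1..card (verts G)}"
    by (auto simp: bij_betw_def)
  have "f u \<noteq> f v" if "e \<in> edges G" "ends G e = {u, v}" for e u v
  proof -
    have "ends G e \<subseteq> verts G \<and> card (ends G e) = 2"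
      using assms that(1) unfolding finite_mgraph_def by blast
    then have "u \<in> verts G" "v \<in> verts G" "u \<noteq> v"
      using that(2) by auto
    then show ?thesis using inj_onD[OF f(1)] by blast
  qed
  then have "colourable G (card (verts G))"
    using f(2) unfolding colourable_def proper_colouring_def by blast
  then show ?thesis unfolding chromatic_number_def by (rule LeastI)
qed

lemma edge_colourable_edge_chromatic_number:
  assumes "finite_mgraph G"
  shows "edge_colourable G (edge_chromatic_number G)"
proof -
  obtain f where "bij_betw f (edges G) {1..card (edges G)}"
    using assms finite_same_card_bij[of "edges G" "{1..card (edges G)}"]
    unfolding finite_mgraph_def by auto
  then have "edge_colourable G (card (edges G))"
    unfolding edge_colourable_def proper_edge_colouring_def bij_betw_def inj_on_def by blast
  then show ?thesis unfolding edge_chromatic_number_def by (rule LeastI)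
qed

lemma colourable_link_graph_0:
  assumes "colourable G k"
  shows "colourable (link_graph 0 G) k"
proof -
  obtain c where c: "proper_colouring G k c"
    using assms unfolding colourable_def by blast
  have "arc_colouring 0 G k (\<lambda>p. c (hd (fst p)))"
    using c unfolding arc_colouring_def proper_colouring_def
    by (auto simp: arcs_def rev_arc_def arc_init_def arc_tail_def length_Suc_conv)
  then show ?thesis using colourable_link_graph_iff_arc_colouring by blast
qed

lemma colourable_link_graph_1:
  assumes "edge_colourable G k"
  shows "colourable (link_graph 1 G) k"
proof -
  obtain c where c: "proper_edge_colouring G k c"
    using assms unfolding edge_colourable_def by blast
  have "c (hd (snd (arc_init q))) \<noteq> c (hd (snd (arc_tail q)))" if arc: "q \<in> arcs (Suc 1) G" for q
  proof -
    obtain u v w e f where q: "q = ([u, v, w], [e, f])"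
      using arc by (cases q) (auto simp: arcs_def length_Suc_conv numeral_3_eq_3 numeral_2_eq_2)
    have "e \<in> edges G" "f \<in> edges G" "e \<noteq> f" "ends G e = {u, v}" "ends G f = {v, w}"
      using arc by (auto simp: q arcs_def less_Suc_eq all_conj_distrib)
    then have "c e \<noteq> c f"
      using c unfolding proper_edge_colouring_def by blast
    then show ?thesis by (simp add: q arc_init_def arc_tail_def)
  qed
  then have "arc_colouring 1 G k (\<lambda>p. c (hd (snd p)))"
    using c unfolding arc_colouring_def proper_edge_colouring_def
    by (auto simp: arcs_def rev_arc_def length_Suc_conv)
  then show ?thesis using colourable_link_graph_iff_arc_colouring by blast
qed

theorem corollary1p2:
  fixes G :: "('v, 'e) mgraph" and l :: nat
  assumes "finite_mgraph G"
  shows "(even l \<and>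
            (chromatic_number G \<le> 3 \<or>
             real l > 2 * log (3 / 2) (real (chromatic_number G) - 3))
          \<longrightarrow> colourable (link_graph l G) 3) \<and>
         (odd l \<and>
            (edge_chromatic_number G \<le> 3 \<or>
             real l > 2 * log (3 / 2) (real (edge_chromatic_number G) - 3) + 1)
          \<longrightarrow> colourable (link_graph l G) 3)"
proof (intro conjI impI; elim conjE)
  assume "even l" and l: "chromatic_number G \<le> 3 \<or>
    real l > 2 * log (3 / 2) (real (chromatic_number G) - 3)"
  then obtain t where t: "l = 0 + 2 * t" by auto
  show "colourable (link_graph l G) 3"
    unfolding t
    by (rule colourable_link_graph_3[OF colourable_link_graph_0[OF
          colourable_chromatic_number[OF assms]]]) (use l t in auto)
next
  assume "odd l" and l: "edge_chromatic_number G \<le> 3 \<or>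
    real l > 2 * log (3 / 2) (real (edge_chromatic_number G) - 3) + 1"
  then obtain t where t: "l = 1 + 2 * t" by (metis add.commute oddE)
  show "colourable (link_graph l G) 3"
    unfolding t
    by (rule colourable_link_graph_3[OF colourable_link_graph_1[OF
          edge_colourable_edge_chromatic_number[OF assms]]]) (use l t in auto)
qed

end
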